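(* For every general preference $\Psi$, the function $w_\Psi$ is an admissible weight function; that is, $w_\Psi$ assigns a non-negative number to each trajectory, and for all trajectories $\alpha,\beta$: (i) if $\alpha\prec_\Psi\beta$ then $w_\Psi(\alpha)>w_\Psi(\beta)$; and (ii) if $\alpha\approx_\Psi\beta$ then $w_\Psi(\alpha)=w_\Psi(\beta)$.
   Context: A trajectory is a finite alternating sequence $s_0a_1s_1\ldots a_ns_n$ ($n\ge0$) of states and actions with $s_{i+1}\in\Phi(a_{i+1},s_i)$, where $\Phi$ is the transition function of a fixed action theory; states are complete consistent sets of fluent literals satisfying the static laws of the theory. $\alpha[i]$ denotes $s_ia_{i+1}\ldots a_ns_n$. Basic desire formulas are built from fluent formulas (propositional formulas over fluents), $occ(a)$ ($a$ an action) and $\mathbf{goal}(\psi)$ ($\psi$ a fluent formula) by $\wedge,\vee,\neg,\mathbf{next},\mathbf{until},\mathbf{always},\mathbf{eventually}$. Satisfaction by $\alpha=s_0a_1\ldots a_ns_n$: $\mathbf{goal}(\psi)$ iff $s_n\models\psi$; fluent formula $\psi$ iff $s_0\models\psi$; $occ(a)$ iff $n\ge1$ and $a_1=a$; Boolean connectives as usual; $\mathbf{next}(\psi)$ iff $n\ge1$ and $\alpha[1]\models\psi$; $\mathbf{always}(\psi)$ iff $\alpha[i]\models\psi$ for all $0\le i\le n$; $\mathbf{eventually}(\psi)$ iff $\alpha[i]\models\psi$ for some $0\le i\le n$; $\mathbf{until}(\psi_1,\psi_2)$ iff for some $0\le i\le n$, $\alpha[i]\models\psi_2$ and $\alpha[j]\models\psi_1$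 for all $0\le j<i$. For a basic desire $\varphi$: $\alpha\prec_\varphi\beta$ iff $\alpha\models\varphi$ and $\beta\not\models\varphi$; $\alpha\approx_\varphi\beta$ iff both or neither satisfy $\varphi$. An atomic preference is $\Psi=\varphi_1\lhd\cdots\lhd\varphi_n$ ($\varphi_i$ basic desires): $\alpha\approx_\Psi\beta$ iff $\alpha\approx_{\varphi_i}\beta$ for all $i$; $\alpha\prec_\Psi\beta$ iff for some $i$, $\alpha\approx_{\varphi_j}\beta$ for all $j<i$ and $\alpha\prec_{\varphi_i}\beta$. General preferences: atomic preferences; $\Psi_1\&\Psi_2$, $\Psi_1\mid\Psi_2$, $!\Psi_1$, and $\Psi_1\lhd\cdots\lhd\Psi_k$ for general preferences $\Psi_i$. The relations: for $\Psi_1\&\Psi_2$, $\alpha\prec\beta$ iff $\alpha\prec_{\Psi_1}\beta$ and $\alpha\prec_{\Psi_2}\beta$; for $\Psi_1\mid\Psi_2$, $\alpha\prec\beta$ iff ($\alpha\prec_{\Psi_1}\beta$ and $\alpha\approx_{\Psi_2}\beta$) or ($\alpha\prec_{\Psi_2}\beta$ and $\alpha\approx_{\Psi_1}\beta$) or ($\alpha\prec_{\Psi_1}\beta$ and $\alpha\prec_{\Psi_2}\beta$); in both cases $\alpha\approx\beta$ iff $\alpha\approx_{\Psi_1}\beta$ and $\alpha\approx_{\Psi_2}\beta$; for $!\Psi_1$, $\alpha\prec\beta$ iff $\beta\prec_{\Psi_1}\alpha$, and $\alpha\approx\beta$ iff $\alpha\approx_{\Psi_1}\beta$; for $\Psi_1\lhd\cdots\lhd\Psi_k$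 the same lexicographic definition as for atomic preferences. Weights: for a basic desire $\varphi$, $w_\varphi(\alpha)=1$ if $\alpha\models\varphi$ and $0$ otherwise. For an atomic preference $\psi=\varphi_1\lhd\cdots\lhd\varphi_k$, $w_\psi(\alpha)=\sum_{r=1}^k 2^{k-r}w_{\varphi_r}(\alpha)$. For general preferences: $w_{\Psi_1\&\Psi_2}(\alpha)=w_{\Psi_1\mid\Psi_2}(\alpha)=w_{\Psi_1}(\alpha)+w_{\Psi_2}(\alpha)$; $w_{!\Psi_1}(\alpha)=max(\Psi_1)-w_{\Psi_1}(\alpha)$; $w_{\Psi_1\lhd\Psi_2}(\alpha)=max(\Psi_2)\,w_{\Psi_1}(\alpha)+w_{\Psi_2}(\alpha)$, where $max(\Psi_i)$ is one plus the maximum weight $w_{\Psi_i}$ achieved by a trajectory. Chains of more than two (non-atomic) preferences are read as nested chains of length 2: $\Psi_1\lhd\Psi_2\lhd\Psi_3$ as $\Psi_1\lhd(\Psi_2\lhd\Psi_3)$, etc. *)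

theory Defs
  imports Main
begin

datatype 'f literal = Pos 'f | Neg 'f

type_synonym 'f state = "'f literal set"

text \<open>A static law \<open>(P, l)\<close> says that the literal \<open>l\<close> holds in every state in which
  all literals of \<open>P\<close> hold. The transition function is an arbitrary (nondeterministic) one:
  nothing below depends on the laws from which it is obtained.\<close>

record ('f, 'a) action_theory =
  static_laws :: "('f literal set \<times> 'f literal) set"
  transition :: "'a \<Rightarrow> 'f state \<Rightarrow> 'f state set"

definition complete :: "'f literal set \<Rightarrow> bool" where
  "complete s \<longleftrightarrow> (\<forall>f. Pos f \<in> s \<or> Neg f \<in> s)"

definition consistent :: "'f literal set \<Rightarrow> bool" where
  "consistent s \<longleftrightarrow> (\<nexists>f. Pos f \<in> s \<and> Neg f \<in> s)"

definition states :: "('f, 'a) action_theory \<Rightarrow> 'f state set" where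
  "states D = {s. complete s \<and> consistent s \<and>
                  (\<forall>(P, l) \<in> static_laws D. P \<subseteq> s \<longrightarrow> l \<in> s)}"

text \<open>The sequence \<open>s\<^sub>0 a\<^sub>1 s\<^sub>1 \<dots> a\<^sub>n s\<^sub>n\<close> is represented as
  \<open>(s\<^sub>0, [(a\<^sub>1, s\<^sub>1), \<dots>, (a\<^sub>n, s\<^sub>n)])\<close>.\<close>

type_synonym ('f, 'a) traj = "'f state \<times> ('a \<times> 'f state) list"

definition traj_length :: "('f, 'a) traj \<Rightarrow> nat" where
  "traj_length \<alpha> = length (snd \<alpha>)"

definition state_at :: "('f, 'a) traj \<Rightarrow> nat \<Rightarrow> 'f state" where
  "state_at \<alpha> i = (fst \<alpha> # map snd (snd \<alpha>)) ! i"

text \<open>The actions of a trajectory are numbered from 1.\<close>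

definition action_at :: "('f, 'a) traj \<Rightarrow> nat \<Rightarrow> 'a" where
  "action_at \<alpha> i = fst (snd \<alpha> ! (i - 1))"

definition suffix :: "('f, 'a) traj \<Rightarrow> nat \<Rightarrow> ('f, 'a) traj" where
  "suffix \<alpha> i = (state_at \<alpha> i, drop i (snd \<alpha>))"

definition trajectories :: "('f, 'a) action_theory \<Rightarrow> ('f, 'a) traj set" where
  "trajectories D = {\<alpha>.
     (\<forall>i\<le>traj_length \<alpha>. state_at \<alpha> i \<in> states D) \<and>
     (\<forall>i<traj_length \<alpha>.
        state_at \<alpha> (i + 1) \<in> transition D (action_at \<alpha> (i + 1)) (state_at \<alpha> i))}"

datatype 'f fluent_formula =
    Fluent 'f
  | FNot "'f fluent_formula"
  | FAnd "'f fluent_formula" "'f fluent_formula"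
  | FOr "'f fluent_formula" "'f fluent_formula"

primrec holds :: "'f state \<Rightarrow> 'f fluent_formula \<Rightarrow> bool" where
  "holds s (Fluent f) \<longleftrightarrow> Pos f \<in> s"
| "holds s (FNot \<psi>) \<longleftrightarrow> \<not> holds s \<psi>"
| "holds s (FAnd \<psi>1 \<psi>2) \<longleftrightarrow> holds s \<psi>1 \<and> holds s \<psi>2"
| "holds s (FOr \<psi>1 \<psi>2) \<longleftrightarrow> holds s \<psi>1 \<or> holds s \<psi>2"

datatype ('f, 'a) desire =
    Formula "'f fluent_formula"
  | Occ 'a
  | Goal "'f fluent_formula"
  | DNot "('f, 'a) desire"
  | DAnd "('f, 'a) desire" "('f, 'a) desire"
  | DOr "('f, 'a) desire" "('f, 'a) desire"
  | Next "('f, 'a) desire"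
  | Until "('f, 'a) desire" "('f, 'a) desire"
  | Always "('f, 'a) desire"
  | Eventually "('f, 'a) desire"

primrec sat :: "('f, 'a) traj \<Rightarrow> ('f, 'a) desire \<Rightarrow> bool" where
  "sat \<alpha> (Formula \<psi>) \<longleftrightarrow> holds (state_at \<alpha> 0) \<psi>"
| "sat \<alpha> (Occ a) \<longleftrightarrow> traj_length \<alpha> \<ge> 1 \<and> action_at \<alpha> 1 = a"
| "sat \<alpha> (Goal \<psi>) \<longleftrightarrow> holds (state_at \<alpha> (traj_length \<alpha>)) \<psi>"
| "sat \<alpha> (DNot \<phi>) \<longleftrightarrow> \<not> sat \<alpha> \<phi>"
| "sat \<alpha> (DAnd \<phi>1 \<phi>2) \<longleftrightarrow> sat \<alpha> \<phi>1 \<and> sat \<alpha> \<phi>2"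
| "sat \<alpha> (DOr \<phi>1 \<phi>2) \<longleftrightarrow> sat \<alpha> \<phi>1 \<or> sat \<alpha> \<phi>2"
| "sat \<alpha> (Next \<phi>) \<longleftrightarrow> traj_length \<alpha> \<ge> 1 \<and> sat (suffix \<alpha> 1) \<phi>"
| "sat \<alpha> (Until \<phi>1 \<phi>2) \<longleftrightarrow>
     (\<exists>i\<le>traj_length \<alpha>. sat (suffix \<alpha> i) \<phi>2 \<and> (\<forall>j<i. sat (suffix \<alpha> j) \<phi>1))"
| "sat \<alpha> (Always \<phi>) \<longleftrightarrow> (\<forall>i\<le>traj_length \<alpha>. sat (suffix \<alpha> i) \<phi>)"
| "sat \<alpha> (Eventually \<phi>) \<longleftrightarrow> (\<exists>i\<le>traj_length \<alpha>. sat (suffix \<alpha> i) \<phi>)"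

text \<open>\<open>Atomic [\<phi>\<^sub>1, \<dots>, \<phi>\<^sub>n]\<close> is the chain of the basic desires \<open>\<phi>\<^sub>i\<close>, and
  \<open>Chain [\<Psi>\<^sub>1, \<dots>, \<Psi>\<^sub>k]\<close> the chain of the general preferences \<open>\<Psi>\<^sub>i\<close>. The type
  also contains empty chains; these are excluded by \<open>general_pref\<close>.\<close>

datatype ('f, 'a) pref =
    Atomic "('f, 'a) desire list"
  | PAnd "('f, 'a) pref" "('f, 'a) pref"
  | POr "('f, 'a) pref" "('f, 'a) pref"
  | PNot "('f, 'a) pref"
  | Chain "('f, 'a) pref list"

inductive general_pref :: "('f, 'a) pref \<Rightarrow> bool" where
  "\<phi>s \<noteq> [] \<Longrightarrow> general_pref (Atomic \<phi>s)"
| "general_pref \<Psi>1 \<Longrightarrow> general_pref \<Psi>2 \<Longrightarrow> general_pref (PAnd \<Psi>1 \<Psi>2)"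
| "general_pref \<Psi>1 \<Longrightarrow> general_pref \<Psi>2 \<Longrightarrow> general_pref (POr \<Psi>1 \<Psi>2)"
| "general_pref \<Psi> \<Longrightarrow> general_pref (PNot \<Psi>)"
| "\<Psi>s \<noteq> [] \<Longrightarrow> (\<And>\<Psi>. \<Psi> \<in> set \<Psi>s \<Longrightarrow> general_pref \<Psi>) \<Longrightarrow> general_pref (Chain \<Psi>s)"

definition desire_less :: "('f, 'a) desire \<Rightarrow> ('f, 'a) traj \<Rightarrow> ('f, 'a) traj \<Rightarrow> bool" where
  "desire_less \<phi> \<alpha> \<beta> \<longleftrightarrow> sat \<alpha> \<phi> \<and> \<not> sat \<beta> \<phi>"

definition desire_equiv :: "('f, 'a) desire \<Rightarrow> ('f, 'a) traj \<Rightarrow> ('f, 'a) traj \<Rightarrow> bool" where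
  "desire_equiv \<phi> \<alpha> \<beta> \<longleftrightarrow> (sat \<alpha> \<phi> \<longleftrightarrow> sat \<beta> \<phi>)"

lemma size_nth_less [termination_simp]:
  "i < length xs \<Longrightarrow> size (xs ! i) < Suc (size_list size xs)"
  using size_list_estimation'[of "xs ! i" xs "size (xs ! i)" size] by (simp add: less_Suc_eq_le)

context
  notes conj_cong [fundef_cong]
begin

fun pref_equiv :: "('f, 'a) pref \<Rightarrow> ('f, 'a) traj \<Rightarrow> ('f, 'a) traj \<Rightarrow> bool" where
  "pref_equiv (Atomic \<phi>s) \<alpha> \<beta> \<longleftrightarrow> (\<forall>i<length \<phi>s. desire_equiv (\<phi>s ! i) \<alpha> \<beta>)"
| "pref_equiv (PAnd \<Psi>1 \<Psi>2) \<alpha> \<beta> \<longleftrightarrow> pref_equiv \<Psi>1 \<alpha> \<beta> \<and> pref_equiv \<Psi>2 \<alpha> \<beta>"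
| "pref_equiv (POr \<Psi>1 \<Psi>2) \<alpha> \<beta> \<longleftrightarrow> pref_equiv \<Psi>1 \<alpha> \<beta> \<and> pref_equiv \<Psi>2 \<alpha> \<beta>"
| "pref_equiv (PNot \<Psi>) \<alpha> \<beta> \<longleftrightarrow> pref_equiv \<Psi> \<alpha> \<beta>"
| "pref_equiv (Chain \<Psi>s) \<alpha> \<beta> \<longleftrightarrow> (\<forall>i<length \<Psi>s. pref_equiv (\<Psi>s ! i) \<alpha> \<beta>)"

text \<open>Smaller means more preferred.\<close>

fun pref_less :: "('f, 'a) pref \<Rightarrow> ('f, 'a) traj \<Rightarrow> ('f, 'a) traj \<Rightarrow> bool" where
  "pref_less (Atomic \<phi>s) \<alpha> \<beta> \<longleftrightarrow>
     (\<exists>i<length \<phi>s. (\<forall>j<i. desire_equiv (\<phi>s ! j) \<alpha> \<beta>) \<and> desire_less (\<phi>s ! i) \<alpha> \<beta>)"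
| "pref_less (PAnd \<Psi>1 \<Psi>2) \<alpha> \<beta> \<longleftrightarrow> pref_less \<Psi>1 \<alpha> \<beta> \<and> pref_less \<Psi>2 \<alpha> \<beta>"
| "pref_less (POr \<Psi>1 \<Psi>2) \<alpha> \<beta> \<longleftrightarrow>
     (pref_less \<Psi>1 \<alpha> \<beta> \<and> pref_equiv \<Psi>2 \<alpha> \<beta>) \<or>
     (pref_less \<Psi>2 \<alpha> \<beta> \<and> pref_equiv \<Psi>1 \<alpha> \<beta>) \<or>
     (pref_less \<Psi>1 \<alpha> \<beta> \<and> pref_less \<Psi>2 \<alpha> \<beta>)"
| "pref_less (PNot \<Psi>) \<alpha> \<beta> \<longleftrightarrow> pref_less \<Psi> \<beta> \<alpha>"
| "pref_less (Chain \<Psi>s) \<alpha> \<beta> \<longleftrightarrow>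
     (\<exists>i<length \<Psi>s. (\<forall>j<i. pref_equiv (\<Psi>s ! j) \<alpha> \<beta>) \<and> pref_less (\<Psi>s ! i) \<alpha> \<beta>)"

end

definition desire_weight :: "('f, 'a) desire \<Rightarrow> ('f, 'a) traj \<Rightarrow> int" where
  "desire_weight \<phi> \<alpha> = (if sat \<alpha> \<phi> then 1 else 0)"

text \<open>There may be infinitely many trajectories, but every weight below has only finitely many
  values on them, so \<open>Max\<close> is the true maximum (unless there are no states and hence no
  trajectories at all).\<close>

definition max_plus_one :: "('f, 'a) action_theory \<Rightarrow> (('f, 'a) traj \<Rightarrow> int) \<Rightarrow> int" where
  "max_plus_one D w = 1 + Max (w ` trajectories D)"

text \<open>A chain of preferences is read as nested to the right,
  \<open>\<Psi>\<^sub>1 \<lhd> (\<Psi>\<^sub>2 \<lhd> \<dots>)\<close>. The clause for the empty chain only serves totality. Weights are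
  integers, so that the subtraction for \<open>PNot\<close> is not truncated.\<close>

fun weight :: "('f, 'a) action_theory \<Rightarrow> ('f, 'a) pref \<Rightarrow> ('f, 'a) traj \<Rightarrow> int" where
  "weight D (Atomic \<phi>s) =
     (\<lambda>\<alpha>. \<Sum>r = 1..length \<phi>s. 2 ^ (length \<phi>s - r) * desire_weight (\<phi>s ! (r - 1)) \<alpha>)"
| "weight D (PAnd \<Psi>1 \<Psi>2) = (\<lambda>\<alpha>. weight D \<Psi>1 \<alpha> + weight D \<Psi>2 \<alpha>)"
| "weight D (POr \<Psi>1 \<Psi>2) = (\<lambda>\<alpha>. weight D \<Psi>1 \<alpha> + weight D \<Psi>2 \<alpha>)"
| "weight D (PNot \<Psi>) = (\<lambda>\<alpha>. max_plus_one D (weight D \<Psi>) - weight D \<Psi> \<alpha>)"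
| "weight D (Chain []) = (\<lambda>\<alpha>. 0)"
| "weight D (Chain [\<Psi>]) = weight D \<Psi>"
| "weight D (Chain (\<Psi>1 # \<Psi>2 # \<Psi>s)) =
     (\<lambda>\<alpha>. max_plus_one D (weight D (Chain (\<Psi>2 # \<Psi>s))) * weight D \<Psi>1 \<alpha>
           + weight D (Chain (\<Psi>2 # \<Psi>s)) \<alpha>)"

definition admissible_weight ::
  "('f, 'a) action_theory \<Rightarrow> ('f, 'a) pref \<Rightarrow> (('f, 'a) traj \<Rightarrow> int) \<Rightarrow> bool" where
  "admissible_weight D \<Psi> w \<longleftrightarrow>
     (\<forall>\<alpha>\<in>trajectories D. w \<alpha> \<ge> 0) \<and>
     (\<forall>\<alpha>\<in>trajectories D. \<forall>\<beta>\<in>trajectories D.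
        (pref_less \<Psi> \<alpha> \<beta> \<longrightarrow> w \<alpha> > w \<beta>) \<and> (pref_equiv \<Psi> \<alpha> \<beta> \<longrightarrow> w \<alpha> = w \<beta>))"

end

theory Submission
  imports Defs
begin

text \<open>Structural induction. In a chain \<open>\<Psi>\<^sub>1 \<lhd> \<Psi>\<^sub>2\<close> the factor \<open>max(\<Psi>\<^sub>2)\<close> exceeds every weight of
  \<open>\<Psi>\<^sub>2\<close>, so a gain of at least \<open>1\<close> in the (integer) weight of \<open>\<Psi>\<^sub>1\<close> outweighs any loss in
  \<open>\<Psi>\<^sub>2\<close>; in an atomic preference the powers of \<open>2\<close> play the same role. For \<open>max\<close> to be an upper
  bound, the induction must also carry that each weight takes only finitely many values.\<close>

text \<open>Split on whether the deciding index is \<open>0\<close>. Keeping \<open>P\<close> and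
  \<open>Q\<close> abstract lets it serve both chains of desires and chains of preferences.\<close>

lemma lexicographic_Cons:
  "(\<exists>i<length (x # xs). (\<forall>j<i. P ((x # xs) ! j)) \<and> Q ((x # xs) ! i)) \<longleftrightarrow>
     Q x \<or> P x \<and> (\<exists>i<length xs. (\<forall>j<i. P (xs ! j)) \<and> Q (xs ! i))"
  by (auto simp: Ex_less_Suc2 All_less_Suc2)

text \<open>Over the integers \<open>b < a\<close> means \<open>b + 1 \<le> a\<close>, so the
  leading term grows by at least \<open>M\<close>, which is more than the lost
  \<open>d\<close>.\<close>

lemma lexicographic_weight_less:
  fixes a b c d M :: int
  assumes "b < a" "0 \<le> c" "0 \<le> d" "d < M"
  shows "M * b + d < M * a + c"
proof -
  have "M * (b + 1) \<le> M * a"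
    using assms by (intro mult_left_mono) auto
  then show ?thesis
    using assms by (simp add: algebra_simps)
qed

lemma pref_less_Atomic_Cons:
  "pref_less (Atomic (\<phi> # \<phi>s)) \<alpha> \<beta> \<longleftrightarrow>
     desire_less \<phi> \<alpha> \<beta> \<or> desire_equiv \<phi> \<alpha> \<beta> \<and> pref_less (Atomic \<phi>s) \<alpha> \<beta>"
  unfolding pref_less.simps by (rule lexicographic_Cons)

lemma pref_equiv_Chain_Cons:
  "pref_equiv (Chain (\<Psi> # \<Psi>s)) \<alpha> \<beta> \<longleftrightarrow> pref_equiv \<Psi> \<alpha> \<beta> \<and> pref_equiv (Chain \<Psi>s) \<alpha> \<beta>"
  by (auto simp: All_less_Suc2)

lemma pref_less_Chain_Cons:
  "pref_less (Chain (\<Psi> # \<Psi>s)) \<alpha> \<beta> \<longleftrightarrow>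
     pref_less \<Psi> \<alpha> \<beta> \<or> pref_equiv \<Psi> \<alpha> \<beta> \<and> pref_less (Chain \<Psi>s) \<alpha> \<beta>"
  unfolding pref_less.simps by (rule lexicographic_Cons)

lemma weight_Atomic_Cons:
  "weight D (Atomic (\<phi> # \<phi>s)) \<alpha> =
     2 ^ length \<phi>s * desire_weight \<phi> \<alpha> + weight D (Atomic \<phi>s) \<alpha>"
proof -
  \<comment> \<open>Reindexing from \<open>0\<close> lets the head split off as the first summand;
    the exponents in the rest are then those of the tail.\<close>
  have "(\<Sum>r = 1..length (\<phi> # \<phi>s).
           2 ^ (length (\<phi> # \<phi>s) - r) * desire_weight ((\<phi> # \<phi>s) ! (r - 1)) \<alpha>) =
        (\<Sum>r<length (\<phi> # \<phi>s).
           2 ^ (length (\<phi> # \<phi>s) - Suc r) * desire_weight ((\<phi> # \<phi>s) ! r) \<alpha>)"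
    by (simp only: One_nat_def sum.atLeast1_atMost_eq diff_Suc_Suc diff_zero)
  also have "\<dots> = 2 ^ length \<phi>s * desire_weight \<phi> \<alpha> +
      (\<Sum>r<length \<phi>s. 2 ^ (length \<phi>s - Suc r) * desire_weight (\<phi>s ! r) \<alpha>)"
    by (simp add: sum.lessThan_Suc_shift del: sum.lessThan_Suc)
  also have "(\<Sum>r<length \<phi>s. 2 ^ (length \<phi>s - Suc r) * desire_weight (\<phi>s ! r) \<alpha>) =
      weight D (Atomic \<phi>s) \<alpha>"
    by (simp add: sum.atLeast1_atMost_eq)
  finally show ?thesis by simp
qed

lemma weight_Atomic_nonneg: "0 \<le> weight D (Atomic \<phi>s) \<alpha>"
  by (auto simp: desire_weight_def intro!: sum_nonneg)

text \<open>The weight is a binary number with one digit per desire, the first desire being the most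
  significant digit.\<close>

lemma weight_Atomic_less: "weight D (Atomic \<phi>s) \<alpha> < 2 ^ length \<phi>s"
proof (induction \<phi>s)
  case (Cons \<phi> \<phi>s)
  then show ?case
    by (auto simp: weight_Atomic_Cons desire_weight_def simp del: weight.simps
        intro: order_less_le_trans)
qed simp

lemma weight_Atomic_equiv:
  "pref_equiv (Atomic \<phi>s) \<alpha> \<beta> \<Longrightarrow> weight D (Atomic \<phi>s) \<alpha> = weight D (Atomic \<phi>s) \<beta>"
  by (auto simp: desire_weight_def desire_equiv_def intro!: sum.cong)

text \<open>Binary numbers of equal length are compared at the first digit where they
  differ.\<close>

lemma weight_Atomic_mono:
  "pref_less (Atomic \<phi>s) \<alpha> \<beta> \<Longrightarrow> weight D (Atomic \<phi>s) \<beta> < weight D (Atomic \<phi>s) \<alpha>"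
proof (induction \<phi>s)
  case (Cons \<phi> \<phi>s)
  from Cons.prems consider "desire_less \<phi> \<alpha> \<beta>"
    | "desire_equiv \<phi> \<alpha> \<beta>" "pref_less (Atomic \<phi>s) \<alpha> \<beta>"
    by (auto simp only: pref_less_Atomic_Cons)
  then show ?case
  proof cases
    case 1
    then have "desire_weight \<phi> \<beta> < desire_weight \<phi> \<alpha>"
      by (simp add: desire_less_def desire_weight_def)
    then show ?thesis
      unfolding weight_Atomic_Cons
      by (rule lexicographic_weight_less[OF _ weight_Atomic_nonneg weight_Atomic_nonneg
            weight_Atomic_less])
  next
    case 2
    then have "desire_weight \<phi> \<beta> = desire_weight \<phi> \<alpha>"
      by (simp add: desire_equiv_def desire_weight_def)
    with 2 Cons.IH show ?thesis
      by (simp add: weight_Atomic_Cons del: weight.simps pref_less.simps)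
  qed
qed simp

text \<open>The weights enter the argument only through admissibility, and \<open>M\<close> only as
  a strict upper bound for \<open>w\<close>. The nonempty tail matches the recursive clause of
  \<open>weight\<close> for chains.\<close>

lemma admissible_weight_Chain_Cons:
  assumes \<Psi>: "admissible_weight D \<Psi> v"
    and C: "admissible_weight D (Chain (\<Psi>' # \<Psi>s)) w"
    and bound: "\<And>\<alpha>. \<alpha> \<in> trajectories D \<Longrightarrow> w \<alpha> < M"
  shows "admissible_weight D (Chain (\<Psi> # \<Psi>' # \<Psi>s)) (\<lambda>\<alpha>. M * v \<alpha> + w \<alpha>)"
  unfolding admissible_weight_def
proof (intro conjI ballI impI)
  fix \<alpha>
  assume \<alpha>: "\<alpha> \<in> trajectories D"
  then have nonneg: "0 \<le> v \<alpha>" "0 \<le> w \<alpha>"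
    using \<Psi> C by (simp_all add: admissible_weight_def)
  \<comment> \<open>The sign of \<open>M\<close> comes from the trajectory at hand:
    \<open>0 \<le> w \<alpha> < M\<close>.\<close>
  moreover have "0 \<le> M"
    using nonneg(2) bound[OF \<alpha>] by linarith
  ultimately show "0 \<le> M * v \<alpha> + w \<alpha>"
    by simp
  fix \<beta>
  assume \<beta>: "\<beta> \<in> trajectories D"
  have "0 \<le> w \<beta>"
    using C \<beta> by (simp add: admissible_weight_def)
  \<comment> \<open>The premise left open is the strict gain \<open>v \<beta> < v \<alpha>\<close>
    in the leading component.\<close>
  note less = lexicographic_weight_less[OF _ nonneg(2) this bound[OF \<beta>]]
  have \<Psi>\<alpha>\<beta>: "pref_less \<Psi> \<alpha> \<beta> \<Longrightarrow> v \<beta> < v \<alpha>"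
    "pref_equiv \<Psi> \<alpha> \<beta> \<Longrightarrow> v \<alpha> = v \<beta>"
    using \<Psi> \<alpha> \<beta> by (simp_all only: admissible_weight_def)
  have C\<alpha>\<beta>: "pref_less (Chain (\<Psi>' # \<Psi>s)) \<alpha> \<beta> \<Longrightarrow> w \<beta> < w \<alpha>"
    "pref_equiv (Chain (\<Psi>' # \<Psi>s)) \<alpha> \<beta> \<Longrightarrow> w \<alpha> = w \<beta>"
    using C \<alpha> \<beta> by (simp_all only: admissible_weight_def)
  show "M * v \<beta> + w \<beta> < M * v \<alpha> + w \<alpha>"
    if "pref_less (Chain (\<Psi> # \<Psi>' # \<Psi>s)) \<alpha> \<beta>"
    using that unfolding pref_less_Chain_Cons[of \<Psi>]
  proof (elim disjE conjE)
    assume "pref_less \<Psi> \<alpha> \<beta>"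
    then show ?thesis
      by (rule less[OF \<Psi>\<alpha>\<beta>(1)])
  next
    assume "pref_equiv \<Psi> \<alpha> \<beta>" "pref_less (Chain (\<Psi>' # \<Psi>s)) \<alpha> \<beta>"
    then show ?thesis
      using \<Psi>\<alpha>\<beta>(2) C\<alpha>\<beta>(1) by simp
  qed
  show "M * v \<alpha> + w \<alpha> = M * v \<beta> + w \<beta>"
    if "pref_equiv (Chain (\<Psi> # \<Psi>' # \<Psi>s)) \<alpha> \<beta>"
    using that \<Psi>\<alpha>\<beta>(2) C\<alpha>\<beta>(2) by (simp only: pref_equiv_Chain_Cons[of \<Psi>])
qed

text \<open>All values come from applying \<open>h\<close> to the finite product of the two value
  sets. This carries finiteness through sums and chains.\<close>

lemma finite_image_binop:
  assumes "finite (f ` A)" "finite (g ` A)"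
  shows "finite ((\<lambda>x. h (f x) (g x)) ` A)"
proof -
  have "(\<lambda>x. h (f x) (g x)) ` A \<subseteq> (\<lambda>(u, v). h u v) ` (f ` A \<times> g ` A)"
    by force
  then show ?thesis
    using assms by (meson finite_SigmaI finite_imageI finite_subset)
qed

text \<open>Finiteness makes \<open>Max\<close> a genuine upper bound, and the added one makes it
  strict.\<close>

lemma less_max_plus_one:
  assumes "finite (w ` trajectories D)" "\<alpha> \<in> trajectories D"
  shows "w \<alpha> < max_plus_one D w"
  using Max_ge[OF assms(1), of "w \<alpha>"] assms(2) by (simp add: max_plus_one_def)

definition finite_admissible :: "('f, 'a) action_theory \<Rightarrow> ('f, 'a) pref \<Rightarrow> bool" where
  "finite_admissible D \<Psi> \<longleftrightarrow>
     finite (weight D \<Psi> ` trajectories D) \<and> admissible_weight D \<Psi> (weight D \<Psi>)"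

lemma finite_admissible_Atomic:
  "finite_admissible D (Atomic \<phi>s)"
proof -
  have "weight D (Atomic \<phi>s) ` trajectories D \<subseteq> {0..2 ^ length \<phi>s}"
    by (intro image_subsetI) (simp add: weight_Atomic_nonneg weight_Atomic_less less_imp_le
        del: weight.simps)
  then show ?thesis
    unfolding finite_admissible_def admissible_weight_def
    by (meson finite_atLeastAtMost_int finite_subset weight_Atomic_equiv weight_Atomic_mono
        weight_Atomic_nonneg)
qed

lemma finite_admissible_PAnd:
  assumes "finite_admissible D \<Psi>1" "finite_admissible D \<Psi>2"
  shows "finite_admissible D (PAnd \<Psi>1 \<Psi>2)"
proof -
  note IH = assms[unfolded finite_admissible_def]
  have "finite (weight D (PAnd \<Psi>1 \<Psi>2) ` trajectories D)"
    using IH by (simp add: finite_image_binop[where h = "(+)"])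
  moreover have "admissible_weight D (PAnd \<Psi>1 \<Psi>2) (weight D (PAnd \<Psi>1 \<Psi>2))"
    using IH
    unfolding admissible_weight_def weight.simps pref_less.simps pref_equiv.simps
    by (metis add_nonneg_nonneg add_strict_mono)
  ultimately show ?thesis
    by (simp add: finite_admissible_def)
qed

text \<open>In each of the three disjuncts one summand increases strictly and the other increases or
  stays equal.\<close>

lemma finite_admissible_POr:
  assumes "finite_admissible D \<Psi>1" "finite_admissible D \<Psi>2"
  shows "finite_admissible D (POr \<Psi>1 \<Psi>2)"
proof -
  note IH = assms[unfolded finite_admissible_def]
  have "finite (weight D (POr \<Psi>1 \<Psi>2) ` trajectories D)"
    using IH by (simp add: finite_image_binop[where h = "(+)"])
  moreover have "admissible_weight D (POr \<Psi>1 \<Psi>2) (weight D (POr \<Psi>1 \<Psi>2))"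
    using IH
    unfolding admissible_weight_def weight.simps pref_less.simps pref_equiv.simps
    by (metis add_nonneg_nonneg add_strict_mono add_strict_left_mono add_strict_right_mono)
  ultimately show ?thesis
    by (simp add: finite_admissible_def)
qed

text \<open>Subtraction from a constant reverses the order of weights, just as \<open>PNot\<close>
  swaps the trajectories.\<close>

lemma finite_admissible_PNot:
  assumes "finite_admissible D \<Psi>"
  shows "finite_admissible D (PNot \<Psi>)"
proof -
  note IH = assms[unfolded finite_admissible_def]
  have "finite (weight D (PNot \<Psi>) ` trajectories D)"
    using IH finite_imageI[of "weight D \<Psi> ` trajectories D"
        "\<lambda>u. max_plus_one D (weight D \<Psi>) - u"]
    by (simp add: image_image)
  \<comment> \<open>This bound yields non-negativity of the difference.\<close>
  moreover have "weight D \<Psi> \<alpha> < max_plus_one D (weight D \<Psi>)" if "\<alpha> \<in> trajectories D" for \<alpha>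
    using IH that by (blast intro: less_max_plus_one)
  then have "admissible_weight D (PNot \<Psi>) (weight D (PNot \<Psi>))"
    using IH by (simp add: admissible_weight_def less_imp_le)
  ultimately show ?thesis
    by (simp add: finite_admissible_def)
qed

lemma finite_admissible_Chain_Cons:
  assumes "finite_admissible D \<Psi>1" "finite_admissible D (Chain (\<Psi>2 # \<Psi>s))"
  shows "finite_admissible D (Chain (\<Psi>1 # \<Psi>2 # \<Psi>s))"
  using assms unfolding finite_admissible_def weight.simps(7)
  by (intro conjI finite_image_binop[where h = "\<lambda>u v. _ * u + v"] admissible_weight_Chain_Cons
      less_max_plus_one) auto

text \<open>Induction along the recursion of \<open>weight\<close> supplies a hypothesis for the
  tail of a chain, which is not a subterm of the datatype value.\<close>

lemma finite_admissible: "finite_admissible D \<Psi>"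
proof (induction D \<Psi> rule: weight.induct)
  \<comment> \<open>Empty chain: the weight is constantly \<open>0\<close>, and there is no index at
    which a strict preference could arise.\<close>
  case (5 D)
  show ?case
    by (simp add: finite_admissible_def admissible_weight_def image_constant_conv)
next
  \<comment> \<open>A chain of one member has the same relations and the same weight as that
    member.\<close>
  case (6 D \<Psi>)
  then show ?case
    by (simp add: finite_admissible_def admissible_weight_def)
qed (rule finite_admissible_Atomic finite_admissible_PAnd finite_admissible_POr
    finite_admissible_PNot finite_admissible_Chain_Cons; assumption)+

theorem proposition9:
  fixes D :: "('f, 'a) action_theory" and \<Psi> :: "('f, 'a) pref"
  assumes "general_pref \<Psi>"
  shows "admissible_weight D \<Psi> (weight D \<Psi>)"
  using finite_admissible unfolding finite_admissible_def by blast

end
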